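(* Let $n\ge 1$. The number of parking functions of $1,\ldots,n$ for which the first spot is lucky is \[ \sum_{i=1}^nq_n(i,1)=(n+1)^{n-1}. \]
   Context: There are $n$ spots labeled $1,\ldots,n$ in order along a one-way street, and $n$ cars entering one after another, car $i$ having preference $a_i\in\{1,\ldots,n\}$. Each car drives to its preferred spot and parks there if it is available; otherwise it moves forward and parks in the first available later spot, if any (if none, it fails to park). A parking function of $1,\ldots,n$ is a sequence of preferences $(a_1,\ldots,a_n)$ such that all $n$ cars are able to park. A car is lucky if it parks in its preferred spot; a spot is lucky if the car that parks in it prefers that spot. For $1\le i,j\le n$, $q_n(i,j)$ denotes the number of parking functions of $1,\ldots,n$ in which the $i$-th car prefers the $j$-th spot and the $i$-th car is lucky. *)

theory Defs
  imports Main
begin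

text \<open>Spots and cars are numbered from 1, list positions from 0. The outcome \<open>None\<close> means that the car fails to park.\<close>

definition free_spots :: "nat \<Rightarrow> nat set \<Rightarrow> nat \<Rightarrow> nat set" where
  "free_spots n occ a = {s \<in> {a..n}. s \<notin> occ}"

definition park_car :: "nat \<Rightarrow> nat set \<Rightarrow> nat \<Rightarrow> nat option" where
  "park_car n occ a =
     (if free_spots n occ a = {} then None else Some (Min (free_spots n occ a)))"

fun park_from :: "nat \<Rightarrow> nat set \<Rightarrow> nat list \<Rightarrow> nat option list" where
  "park_from n occ [] = []"
| "park_from n occ (a # as) =
     (case park_car n occ a of
        None \<Rightarrow> None # park_from n occ as
      | Some s \<Rightarrow> Some s # park_from n (insert s occ) as)"

definition parked_at :: "nat \<Rightarrow> nat list \<Rightarrow> nat \<Rightarrow> nat option" where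
  "parked_at n as i = park_from n {} as ! (i - 1)"

definition preference :: "nat list \<Rightarrow> nat \<Rightarrow> nat" where
  "preference as i = as ! (i - 1)"

definition parking_functions :: "nat \<Rightarrow> nat list set" where
  "parking_functions n =
     {as. length as = n \<and> set as \<subseteq> {1..n} \<and> (\<forall>i\<in>{1..n}. parked_at n as i \<noteq> None)}"

definition lucky_car :: "nat \<Rightarrow> nat list \<Rightarrow> nat \<Rightarrow> bool" where
  "lucky_car n as i \<longleftrightarrow> parked_at n as i = Some (preference as i)"

definition lucky_spot :: "nat \<Rightarrow> nat list \<Rightarrow> nat \<Rightarrow> bool" where
  "lucky_spot n as j \<longleftrightarrow> (\<exists>i\<in>{1..n}. parked_at n as i = Some j \<and> preference as i = j)"

definition q :: "nat \<Rightarrow> nat \<Rightarrow> nat \<Rightarrow> nat" where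
  "q n i j = card {as \<in> parking_functions n. preference as i = j \<and> lucky_car n as i}"

end

theory Submission
  imports Defs
begin

text \<open>
  Pollak's circle argument. Add a spot 0 closing the street to a circle of length \<open>n + 1\<close>, so that a
  car driving past spot \<open>n\<close> continues at 0, and allow 0 as a preference. All \<open>n\<close> cars now
  park and leave exactly one spot empty; the parking functions are the sequences that leave 0 empty.
  Rotating the preferences rotates the empty spot, so each of the \<open>n + 1\<close> spots is left empty by
  equally many of the \<open>(n + 1) ^ n\<close> sequences. Finally, spot 1 of a parking function is always
  lucky, since a car parked there cannot prefer a later spot.
\<close>

section \<open>Parking on a circle of \<open>N\<close> spots\<close>

definition circ_spot :: "nat \<Rightarrow> nat set \<Rightarrow> nat \<Rightarrow> nat" where
  "circ_spot N occ a = (a + (LEAST k. (a + k) mod N \<notin> occ)) mod N"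

text \<open>Only the occupied set is recorded: the counting depends on which spot stays empty, not
  on which car parks where.\<close>

fun circ_park :: "nat \<Rightarrow> nat set \<Rightarrow> nat list \<Rightarrow> nat set" where
  "circ_park N occ [] = occ"
| "circ_park N occ (a # as) = circ_park N (insert (circ_spot N occ a) occ) as"

definition rot :: "nat \<Rightarrow> nat \<Rightarrow> nat \<Rightarrow> nat" where
  "rot N c x = (x + c) mod N"

lemma circ_spot_less: "N > 0 \<Longrightarrow> circ_spot N occ a < N"
  by (simp add: circ_spot_def)

text \<open>The inclusion is proper because the \<open>LEAST\<close> in \<open>circ_spot\<close> is
  unspecified when every spot is taken. Any free \<open>s\<close> is reached by driving on to spot 0
  and \<open>s\<close> steps further.\<close>

lemma circ_spot_free:
  assumes "occ \<subset> {..<N}" "a < N"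
  shows "circ_spot N occ a \<notin> occ"
proof -
  obtain s where s: "s < N" "s \<notin> occ" using assms(1) by auto
  have "(a + (N - a + s)) mod N = s" using s assms(2) by simp
  with s have "\<exists>k. (a + k) mod N \<notin> occ" by metis
  then show ?thesis unfolding circ_spot_def by (rule LeastI_ex)
qed

lemma circ_park_subset:
  "N > 0 \<Longrightarrow> occ \<subseteq> {..<N} \<Longrightarrow> circ_park N occ as \<subseteq> {..<N}"
  by (induction as arbitrary: occ) (auto simp: circ_spot_less)

lemma circ_park_mono: "occ \<subseteq> circ_park N occ as"
  by (induction as arbitrary: occ) (simp, fastforce)

lemma card_circ_park:
  assumes "occ \<subseteq> {..<N}" "set as \<subseteq> {..<N}" "card occ + length as \<le> N"
  shows "card (circ_park N occ as) = card occ + length as"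
  using assms
proof (induction as arbitrary: occ)
  case (Cons a as)
  have fin: "finite occ" using Cons.prems(1) finite_subset by blast
  \<comment> \<open>At least car \<open>a\<close> is still to be parked, so the bound leaves a free
    spot.\<close>
  have "occ \<noteq> {..<N}" using Cons.prems(3) by auto
  then have free: "circ_spot N occ a \<notin> occ"
    using circ_spot_free[of occ N a] Cons.prems by auto
  moreover have "circ_spot N occ a < N" using Cons.prems by (intro circ_spot_less) auto
  ultimately show ?case using Cons.IH[of "insert (circ_spot N occ a) occ"] Cons.prems fin by simp
qed simp

section \<open>Rotations of the circle\<close>

lemma inj_on_rot: "inj_on (rot N c) {..<N}"
proof (rule inj_onI)
  fix x y assume xy: "x \<in> {..<N}" "y \<in> {..<N}" "rot N c x = rot N c y"
  \<comment> \<open>Congruence on \<open>nat\<close> is written with multiples of \<open>N\<close>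
    added on both sides, so that \<open>c\<close> can be cancelled without subtraction.\<close>
  then obtain k l where "x + c + N * k = y + c + N * l"
    unfolding rot_def nat_mod_eq_iff by blast
  then have "x + N * k = y + N * l" by simp
  then have "(x + N * k) mod N = (y + N * l) mod N" by simp
  then show "x = y" using xy by simp
qed

lemma rot_less: "N > 0 \<Longrightarrow> rot N c x < N"
  by (simp add: rot_def)

lemma rot_image_lessThan: "rot N c ` {..<N} = {..<N}"
  by (rule endo_inj_surj) (auto simp: inj_on_rot rot_def intro!: mod_less_divisor)

lemma rot_in_image_iff:
  "occ \<subseteq> {..<N} \<Longrightarrow> x < N \<Longrightarrow> rot N c x \<in> rot N c ` occ \<longleftrightarrow> x \<in> occ"
  using inj_on_image_mem_iff[OF inj_on_rot] by blast

text \<open>\<open>circ_spot\<close> searches over distances, not spots. Rotation is injective, so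
  the spot at distance \<open>k\<close> is occupied after rotating iff it was before, and both
  searches have the same \<open>LEAST\<close>.\<close>

lemma circ_spot_rot:
  assumes "occ \<subseteq> {..<N}" "a < N"
  shows "circ_spot N (rot N c ` occ) (rot N c a) = rot N c (circ_spot N occ a)"
proof -
  have shift: "(rot N c a + k) mod N = rot N c ((a + k) mod N)" for k
    unfolding rot_def mod_add_left_eq by (simp only: ac_simps)
  have "(rot N c a + k) mod N \<notin> rot N c ` occ \<longleftrightarrow> (a + k) mod N \<notin> occ" for k
    unfolding shift using assms by (subst rot_in_image_iff) auto
  then show ?thesis unfolding circ_spot_def by (simp add: shift)
qed

lemma circ_park_rot:
  assumes "occ \<subseteq> {..<N}" "set as \<subseteq> {..<N}"
  shows "circ_park N (rot N c ` occ) (map (rot N c) as) = rot N c ` circ_park N occ as"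
  using assms
proof (induction as arbitrary: occ)
  case (Cons a as)
  have "circ_spot N occ a < N" using Cons.prems by (intro circ_spot_less) auto
  then show ?case
    using Cons.IH[of "insert (circ_spot N occ a) occ"] Cons.prems by (simp add: circ_spot_rot)
qed simp

section \<open>Counting preference lists by the spot left empty\<close>

definition leaving_empty :: "nat \<Rightarrow> nat \<Rightarrow> nat \<Rightarrow> nat list set" where
  "leaving_empty N n e = {as. set as \<subseteq> {..<N} \<and> length as = n \<and> e \<notin> circ_park N {} as}"

lemma leaving_empty_rot:
  assumes "e < N"
  shows "map (rot N e) ` leaving_empty N n 0 = leaving_empty N n e"
proof -
  have 0: "rot N e 0 = e" using assms by (simp add: rot_def)
  have iff: "map (rot N e) as \<in> leaving_empty N n e \<longleftrightarrow> as \<in> leaving_empty N n 0"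
    if "set as \<subseteq> {..<N}" for as
  proof -
    have "e \<in> circ_park N {} (map (rot N e) as) \<longleftrightarrow> rot N e 0 \<in> rot N e ` circ_park N {} as"
      using circ_park_rot[of "{}" N as e] that 0 by simp
    also have "\<dots> \<longleftrightarrow> 0 \<in> circ_park N {} as"
      using assms by (intro rot_in_image_iff circ_park_subset) auto
    finally show ?thesis using that assms by (auto simp: leaving_empty_def rot_less)
  qed
  have "as \<in> map (rot N e) ` leaving_empty N n 0" if as: "as \<in> leaving_empty N n e" for as
  proof -
    \<comment> \<open>Since \<open>rot N e\<close> permutes \<open>{..<N}\<close>, every list over
      \<open>{..<N}\<close> is a rotated one; no inverse rotation has to be written down.\<close>
    have "as \<in> lists (rot N e ` {..<N})"
      using as unfolding rot_image_lessThan by (auto simp: leaving_empty_def)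
    then obtain bs where "as = map (rot N e) bs" "bs \<in> lists {..<N}"
      unfolding lists_image by blast
    with iff[of bs] as show ?thesis by auto
  qed
  moreover have "map (rot N e) as \<in> leaving_empty N n e" if "as \<in> leaving_empty N n 0" for as
    using iff[of as] that by (simp add: leaving_empty_def)
  ultimately show ?thesis by blast
qed

lemma card_leaving_empty_eq:
  assumes "e < N"
  shows "card (leaving_empty N n e) = card (leaving_empty N n 0)"
proof -
  have "inj_on (map (rot N e)) (leaving_empty N n 0)"
    by (rule inj_on_mapI, rule inj_on_subset[OF inj_on_rot]) (auto simp: leaving_empty_def)
  then show ?thesis using card_image leaving_empty_rot[OF assms] by metis
qed

lemma card_leaving_empty_0:
  assumes "n \<ge> 1"
  shows "card (leaving_empty (n + 1) n 0) = (n + 1) ^ (n - 1)"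
proof -
  let ?N = "n + 1"
  let ?T = "{as. set as \<subseteq> {..<?N} \<and> length as = n}"
  \<comment> \<open>Existence of the empty spot makes the classes
    \<open>leaving_empty ?N n e\<close> cover \<open>?T\<close>; its uniqueness makes them
    disjoint.\<close>
  have one: "\<exists>e. {..<?N} - circ_park ?N {} as = {e}" if "as \<in> ?T" for as
  proof -
    have "circ_park ?N {} as \<subseteq> {..<?N}" "card (circ_park ?N {} as) = n"
      using that circ_park_subset[of ?N "{}" as] card_circ_park[of "{}" ?N as] by auto
    then have "card ({..<?N} - circ_park ?N {} as) = 1"
      by (subst card_Diff_subset) (auto intro: finite_subset)
    then show ?thesis by (rule card_1_singletonE) blast
  qed
  have fin: "finite ?T" by (rule finite_lists_length_eq) simp
  have "?T = (\<Union>e<?N. leaving_empty ?N n e)"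
  proof (intro set_eqI iffI)
    fix as assume as: "as \<in> ?T"
    with one obtain e where "e \<in> {..<?N} - circ_park ?N {} as" by blast
    with as show "as \<in> (\<Union>e<?N. leaving_empty ?N n e)"
      unfolding leaving_empty_def by blast
  qed (auto simp: leaving_empty_def)
  then have "card ?T = card (\<Union>e<?N. leaving_empty ?N n e)" by simp
  also have "\<dots> = (\<Sum>e<?N. card (leaving_empty ?N n e))"
  proof (rule card_UN_disjoint)
    show "\<forall>e\<in>{..<?N}. finite (leaving_empty ?N n e)"
      using fin by (auto simp: leaving_empty_def intro: finite_subset[rotated])
    show "\<forall>e\<in>{..<?N}. \<forall>e'\<in>{..<?N}. e \<noteq> e' \<longrightarrow> leaving_empty ?N n e \<inter> leaving_empty ?N n e' = {}"
    proof (intro ballI impI)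
      fix e e' assume e: "e \<in> {..<?N}" "e' \<in> {..<?N}" "e \<noteq> e'"
      have False if as: "as \<in> leaving_empty ?N n e" "as \<in> leaving_empty ?N n e'" for as
      proof -
        have "as \<in> ?T" using as(1) by (simp add: leaving_empty_def)
        then obtain d where "{..<?N} - circ_park ?N {} as = {d}" using one by blast
        moreover have "e \<in> {..<?N} - circ_park ?N {} as" "e' \<in> {..<?N} - circ_park ?N {} as"
          using as e by (simp_all add: leaving_empty_def)
        ultimately show False using e(3) by simp
      qed
      then show "leaving_empty ?N n e \<inter> leaving_empty ?N n e' = {}" by blast
    qed
  qed simp
  also have "\<dots> = (\<Sum>e<?N. card (leaving_empty ?N n 0))"
    by (intro sum.cong refl card_leaving_empty_eq) simp
  also have "\<dots> = ?N * card (leaving_empty ?N n 0)" by simp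
  finally have "?N * card (leaving_empty ?N n 0) = card ?T" ..
  also have "\<dots> = ?N ^ n" using card_lists_length_eq[of "{..<?N}" n] by simp
  \<comment> \<open>One factor is split off to cancel against the number of classes.\<close>
  also have "\<dots> = ?N * ?N ^ (n - 1)"
    using assms by (cases n) simp_all
  finally show ?thesis by (subst (asm) mult_cancel_left) simp
qed

section \<open>Comparison of the street with the circle\<close>

lemma circ_spot_eq:
  assumes "occ \<subseteq> {1..n}" "a \<in> {1..n}"
  shows "circ_spot (n + 1) occ a = (case park_car n occ a of None \<Rightarrow> 0 | Some s \<Rightarrow> s)"
proof (cases "free_spots n occ a = {}")
  case True
  \<comment> \<open>This distance leads to spot 0, which is free because \<open>occ\<close> lies in
    \<open>{1..n}\<close>. Shorter distances stay on the street, where everything from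
    \<open>a\<close> on is taken.\<close>
  have "(LEAST k. (a + k) mod (n + 1) \<notin> occ) = n + 1 - a"
  proof (rule Least_equality)
    show "(a + (n + 1 - a)) mod (n + 1) \<notin> occ" using assms by auto
  next
    fix k assume k: "(a + k) mod (n + 1) \<notin> occ"
    show "n + 1 - a \<le> k"
    proof (rule ccontr)
      assume "\<not> n + 1 - a \<le> k"
      then have "(a + k) mod (n + 1) = a + k" "a + k \<in> {a..n}" by auto
      then show False using k True by (auto simp: free_spots_def)
    qed
  qed
  then show ?thesis using True assms by (simp add: circ_spot_def park_car_def)
next
  case False
  define s where "s = Min (free_spots n occ a)"
  have fin: "finite (free_spots n occ a)" by (simp add: free_spots_def)
  have s: "s \<in> free_spots n occ a" unfolding s_def using fin False by (rule Min_in)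
  \<comment> \<open>As \<open>s \<le> n\<close>, shorter distances do not wrap around, so the
    circular search meets the same spots as the search along the street.\<close>
  have "(LEAST k. (a + k) mod (n + 1) \<notin> occ) = s - a"
  proof (rule Least_equality)
    show "(a + (s - a)) mod (n + 1) \<notin> occ" using s by (auto simp: free_spots_def)
  next
    fix k assume k: "(a + k) mod (n + 1) \<notin> occ"
    show "s - a \<le> k"
    proof (rule ccontr)
      assume less: "\<not> s - a \<le> k"
      then have "(a + k) mod (n + 1) = a + k" using s by (auto simp: free_spots_def)
      then have "a + k \<in> free_spots n occ a" using k s less by (auto simp: free_spots_def)
      then have "s \<le> a + k" unfolding s_def using fin by simp
      then show False using less by simp
    qed
  qed
  then show ?thesis using False s
    by (simp add: circ_spot_def park_car_def flip: s_def) (simp add: free_spots_def)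
qed

lemma park_car_SomeD:
  assumes "park_car n occ a = Some s"
  shows "a \<le> s" "s \<le> n" "s \<notin> occ"
proof -
  have "finite (free_spots n occ a)" by (simp add: free_spots_def)
  then have "s \<in> free_spots n occ a"
    using assms Min_in by (auto simp: park_car_def split: if_splits)
  then show "a \<le> s" "s \<le> n" "s \<notin> occ" by (auto simp: free_spots_def)
qed

lemma circ_spot_0:
  assumes "0 \<notin> occ"
  shows "circ_spot N occ 0 = 0"
proof -
  have "(LEAST k. (0 + k) mod N \<notin> occ) = 0" using assms by (intro Least_equality) auto
  then show ?thesis by (simp add: circ_spot_def)
qed

text \<open>Both processes agree as long as spot 0 is free. The first car to take it either prefers
  0 or fails on the street; spot 0 then stays occupied, and both sides are false.\<close>

lemma zero_notin_circ_park_iff: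
  assumes "occ \<subseteq> {1..n}" "set as \<subseteq> {..<n + 1}"
  shows "0 \<notin> circ_park (n + 1) occ as \<longleftrightarrow> set as \<subseteq> {1..n} \<and> None \<notin> set (park_from n occ as)"
  using assms
proof (induction as arbitrary: occ)
  case Nil
  then show ?case by auto
next
  case (Cons a as)
  have blocked: "0 \<in> circ_park (n + 1) (insert 0 occ) as"
    using circ_park_mono[of "insert 0 occ"] by blast
  show ?case
  proof (cases "a = 0")
    case True
    have "circ_spot (n + 1) occ 0 = 0" using Cons.prems by (intro circ_spot_0) auto
    then show ?thesis using True blocked by simp
  next
    case False
    then have a: "a \<in> {1..n}" using Cons.prems by auto
    show ?thesis
    proof (cases "park_car n occ a")
      case None
      then show ?thesis using circ_spot_eq[OF Cons.prems(1) a] blocked by simp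
    next
      case (Some s)
      have "insert s occ \<subseteq> {1..n}" using park_car_SomeD[OF Some] a Cons.prems by auto
      then show ?thesis
        using Cons.IH[of "insert s occ"] Cons.prems circ_spot_eq[OF Cons.prems(1) a] Some a by simp
    qed
  qed
qed

lemma length_park_from: "length (park_from n occ as) = length as"
  by (induction as arbitrary: occ) (auto split: option.split)

lemma all_parked_iff:
  assumes "length as = n"
  shows "(\<forall>i\<in>{1..n}. parked_at n as i \<noteq> None) \<longleftrightarrow> None \<notin> set (park_from n {} as)"
proof -
  \<comment> \<open>Translates car numbers, starting at 1, into list positions, starting at
    0.\<close>
  have "{1..n} = Suc ` {..<n}" by (simp add: image_Suc_lessThan)
  then show ?thesis using assms
    by (auto simp: parked_at_def in_set_conv_nth length_park_from)
qed

lemma parking_functions_eq_leaving_empty: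
  "parking_functions n = leaving_empty (n + 1) n 0"
proof (intro set_eqI iffI)
  fix as assume as: "as \<in> parking_functions n"
  then have "set as \<subseteq> {..<n + 1}" by (auto simp: parking_functions_def)
  then show "as \<in> leaving_empty (n + 1) n 0"
    using as all_parked_iff zero_notin_circ_park_iff[of "{}" n as]
    unfolding leaving_empty_def parking_functions_def by blast
next
  fix as assume "as \<in> leaving_empty (n + 1) n 0"
  then show "as \<in> parking_functions n"
    using all_parked_iff zero_notin_circ_park_iff[of "{}" n as]
    unfolding leaving_empty_def parking_functions_def by blast
qed

section \<open>Lucky spots of parking functions\<close>

lemma park_from_distinct:
  assumes "None \<notin> set (park_from n occ as)"
  shows "distinct (park_from n occ as) \<and> set (park_from n occ as) \<inter> Some ` occ = {}"
  using assms
proof (induction as arbitrary: occ)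
  case (Cons a as)
  then obtain s where s: "park_car n occ a = Some s" by (cases "park_car n occ a") auto
  \<comment> \<open>Disjointness from the occupied spots is the strengthening that carries the
    induction: for \<open>insert s occ\<close> it says that no later car parks in
    \<open>s\<close>.\<close>
  then show ?case using Cons.IH[of "insert s occ"] Cons.prems park_car_SomeD[OF s] by auto
qed simp

lemma park_from_nth_SomeD:
  assumes "i < length as" "park_from n occ as ! i = Some s"
  shows "as ! i \<le> s \<and> s \<le> n"
  using assms
proof (induction as arbitrary: occ i)
  case (Cons a as)
  then show ?case
    by (cases i) (auto split: option.splits dest: park_car_SomeD)
qed simp

text \<open>The \<open>n\<close> cars take distinct spots in \<open>{1..n}\<close> and so fill them
  all. The car in spot 1 only drove forward, so its preference is at most 1, hence equal to
  1.\<close>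

lemma parking_function_spot_1_lucky:
  assumes "n \<ge> 1" "as \<in> parking_functions n"
  shows "lucky_spot n as 1"
proof -
  let ?P = "park_from n {} as"
  have as: "length as = n" "set as \<subseteq> {1..n}" "None \<notin> set ?P"
    using assms(2) all_parked_iff by (auto simp: parking_functions_def)
  have "set ?P \<subseteq> Some ` {1..n}"
  proof
    fix x assume "x \<in> set ?P"
    then obtain i where i: "i < n" "?P ! i = x" using as by (auto simp: in_set_conv_nth length_park_from)
    moreover obtain s where "x = Some s" using as \<open>x \<in> set ?P\<close> by (cases x) auto
    moreover have "as ! i \<in> {1..n}" using as(1,2) i(1) nth_mem by blast
    ultimately show "x \<in> Some ` {1..n}" using park_from_nth_SomeD[of i as n "{}" s] as by auto
  qed
  moreover have "card (set ?P) = card (Some ` {1..n})"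
    using park_from_distinct[OF as(3)] as by (simp add: distinct_card card_image length_park_from)
  ultimately have "set ?P = Some ` {1..n}" by (intro card_subset_eq) auto
  then have "Some 1 \<in> set ?P" using assms(1) by auto
  then obtain i where i: "i < n" "?P ! i = Some 1"
    using as by (auto simp: in_set_conv_nth length_park_from)
  moreover have "as ! i = 1"
    using park_from_nth_SomeD[of i as n "{}" 1] as(1,2) i nth_mem[of i as] by fastforce
  ultimately show ?thesis unfolding lucky_spot_def parked_at_def preference_def
    by (intro bexI[of _ "i + 1"]) auto
qed

lemma parked_at_inj:
  assumes "as \<in> parking_functions n" "i \<in> {1..n}" "j \<in> {1..n}" "parked_at n as i = parked_at n as j"
  shows "i = j"
proof -
  have "length as = n" "distinct (park_from n {} as)"
    using assms(1) all_parked_iff park_from_distinct by (auto simp: parking_functions_def)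
  then have "i - 1 = j - 1"
    using assms(2-4) unfolding parked_at_def by (subst (asm) nth_eq_iff_index_eq) (auto simp: length_park_from)
  then show ?thesis using assms(2,3) by auto
qed

lemma finite_parking_functions: "finite (parking_functions n)"
  by (rule finite_subset[OF _ finite_lists_length_eq[of "{1..n}" n]])
    (auto simp: parking_functions_def)

text \<open>Classify by the car that makes spot \<open>j\<close> lucky; the classes are disjoint
  because two cars never share a spot.\<close>

lemma card_lucky_spot:
  "card {as \<in> parking_functions n. lucky_spot n as j} = (\<Sum>i=1..n. q n i j)"
proof -
  let ?Q = "\<lambda>i. {as \<in> parking_functions n. preference as i = j \<and> lucky_car n as i}"
  have "{as \<in> parking_functions n. lucky_spot n as j} = (\<Union>i\<in>{1..n}. ?Q i)"
    unfolding lucky_spot_def lucky_car_def by auto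
  also have "card \<dots> = (\<Sum>i=1..n. card (?Q i))"
  proof (rule card_UN_disjoint)
    show "\<forall>i\<in>{1..n}. \<forall>k\<in>{1..n}. i \<noteq> k \<longrightarrow> ?Q i \<inter> ?Q k = {}"
      using parked_at_inj unfolding lucky_car_def by fastforce
  qed (auto simp: finite_parking_functions)
  finally show ?thesis by (simp add: q_def)
qed

theorem mainTheorem6:
  fixes n :: nat
  assumes "n \<ge> 1"
  shows "card {as \<in> parking_functions n. lucky_spot n as 1} = (\<Sum>i=1..n. q n i 1)
       \<and> (\<Sum>i=1..n. q n i 1) = (n + 1) ^ (n - 1)"
proof -
  \<comment> \<open>Luckiness of spot 1 is automatic, so the condition removes no parking
    function.\<close>
  have "{as \<in> parking_functions n. lucky_spot n as 1} = leaving_empty (n + 1) n 0"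
    using parking_function_spot_1_lucky[OF assms] parking_functions_eq_leaving_empty by blast
  then show ?thesis using card_lucky_spot[of n 1] card_leaving_empty_0[OF assms] by simp
qed

end
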